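(* Let $\Gamma$ be a locally finite graph with vertex set $G$, let $S\subset G$ be nonempty and finite, let $h_0:S\to(0,\infty)$ be a function, and assume that $S$ admits a cooling function rel $h_0$. (1) If $N$ is the minimum possible norm of a cooling function for $S$ rel $h_0$, then the reciprocal $1/N$ is given by the minimum value of a convex function $A$ on the simplex $\Delta(S)$ as follows: $$\frac1N=\min_{f\in\Delta(S)}A(f),\qquad A(f)=\sum_{e\in E(S)}\bigl|\tilde f(i(e))-\tilde f(t(e))\bigr|.$$ (2) The minimum possible norm $N$ is given by the maximum Følner ratio: $$N=\max_{S_0\subset S}FR(S_0).$$ (3) If $FR(S_0)$ realizes the maximum in (2), then the function $f\in\Delta(S)$ whose modification $\tilde f$ is constant on $S_0$ and $0$ on $V\setminus S_0$ realizes the minimum in (1).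
   Context: For a finite $S\subset G$, $E(S)$ is the set of edges of $\Gamma$ having at least one vertex in $S$, and $\partial E(S)\subset E(S)$ is the set of edges having exactly one vertex in $S$. Each edge $e\in E(S)$ is given an orientation, with initial vertex $i(e)$ and terminal vertex $t(e)$; for $e\in\partial E(S)$ the orientation is chosen so that $i(e)\in S$ and $t(e)\notin S$; the other orientations are arbitrary. A cooling function for $S$ rel $h_0$ is a function $c:E(S)\to\mathbb R$ such that for every $s\in S$, $\sum_{i(e)=s}c(e)-\sum_{t(e)=s}c(e)\ge h_0(s)$. Its norm is $|c|=\max_{e\in E(S)}|c(e)|$. For $S_0\subset S$ put $H(S_0)=\sum_{s\in S_0}h_0(s)$. For nonempty $S_0\subset S$ the Følner ratio is $FR(S_0)=H(S_0)/|\partial E(S_0)|$ (since $S$ admits a cooling function, $\partial E(S_0)\ne\emptyset$), and $FR(\emptyset)=0$. $\Delta(S)$ is the set of functions $f:S\to[0,1]$ with $\sum_{s\in S}f(s)=1$ (the simplex with vertex set $S$). Let $V$ be the set of all endpoints of edges in $E(S)$. To $f\in\Delta(S)$ is associated its modification $\tilde f:V\to[0,\infty)$ defined by $\tilde f(v)=f(v)/h_0(v)$ for $v\in S$ and $\tilde f(v)=0$ for $v\in V\setminus S$. *)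

theory Defs
  imports Complex_Main "HOL-Library.FuncSet"
begin

text \<open>
  Undirected graphs in which multiple edges and loops are permitted: an edge is an abstract
  object with a set of one (for a loop) or two endpoints.
\<close>

record ('v, 'e) graph =
  verts :: "'v set"
  edges :: "'e set"
  ends :: "'e \<Rightarrow> 'v set"

definition locally_finite_graph :: "('v, 'e) graph \<Rightarrow> bool" where
  "locally_finite_graph \<Gamma> \<longleftrightarrow>
     (\<forall>e \<in> edges \<Gamma>. ends \<Gamma> e \<subseteq> verts \<Gamma> \<and> card (ends \<Gamma> e) \<in> {1, 2}) \<and>
     (\<forall>v \<in> verts \<Gamma>. finite {e \<in> edges \<Gamma>. v \<in> ends \<Gamma> e})"

definition edges_meeting :: "('v, 'e) graph \<Rightarrow> 'v set \<Rightarrow> 'e set" where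
  "edges_meeting \<Gamma> S = {e \<in> edges \<Gamma>. ends \<Gamma> e \<inter> S \<noteq> {}}"

text \<open>
  Edges with one end inside and the other end outside \<open>S\<close>. Counting the elements of
  \<open>ends \<Gamma> e \<inter> S\<close> instead would wrongly include the loops at vertices of \<open>S\<close>.
\<close>

definition boundary_edges :: "('v, 'e) graph \<Rightarrow> 'v set \<Rightarrow> 'e set" where
  "boundary_edges \<Gamma> S = {e \<in> edges_meeting \<Gamma> S. \<not> ends \<Gamma> e \<subseteq> S}"

definition end_vertices :: "('v, 'e) graph \<Rightarrow> 'v set \<Rightarrow> 'v set" where
  "end_vertices \<Gamma> S = (\<Union>e \<in> edges_meeting \<Gamma> S. ends \<Gamma> e)"

definition is_orientation ::
  "('v, 'e) graph \<Rightarrow> 'v set \<Rightarrow> ('e \<Rightarrow> 'v) \<Rightarrow> ('e \<Rightarrow> 'v) \<Rightarrow> bool" where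
  "is_orientation \<Gamma> S i t \<longleftrightarrow>
     (\<forall>e \<in> edges_meeting \<Gamma> S. ends \<Gamma> e = {i e, t e}) \<and>
     (\<forall>e \<in> boundary_edges \<Gamma> S. i e \<in> S \<and> t e \<notin> S)"

definition cooling_functions ::
  "('v, 'e) graph \<Rightarrow> 'v set \<Rightarrow> ('e \<Rightarrow> 'v) \<Rightarrow> ('e \<Rightarrow> 'v) \<Rightarrow> ('v \<Rightarrow> real) \<Rightarrow> ('e \<Rightarrow> real) set" where
  "cooling_functions \<Gamma> S i t h\<^sub>0 =
     {c \<in> edges_meeting \<Gamma> S \<rightarrow>\<^sub>E UNIV.
        \<forall>s \<in> S. (\<Sum>e | e \<in> edges_meeting \<Gamma> S \<and> i e = s. c e)
              - (\<Sum>e | e \<in> edges_meeting \<Gamma> S \<and> t e = s. c e) \<ge> h\<^sub>0 s}"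

definition cooling_norm :: "('v, 'e) graph \<Rightarrow> 'v set \<Rightarrow> ('e \<Rightarrow> real) \<Rightarrow> real" where
  "cooling_norm \<Gamma> S c = Max ((\<lambda>e. \<bar>c e\<bar>) ` edges_meeting \<Gamma> S)"

text \<open>
  If \<open>S\<close> is finite, \<open>h\<^sub>0\<close> is positive on \<open>S\<close> and \<open>S\<close> admits a cooling function, then every
  nonempty subset of \<open>S\<close> has a boundary edge, so the quotient is never a division by zero
  on the sets to which it is applied.
\<close>

definition folner_ratio :: "('v, 'e) graph \<Rightarrow> ('v \<Rightarrow> real) \<Rightarrow> 'v set \<Rightarrow> real" where
  "folner_ratio \<Gamma> h\<^sub>0 S\<^sub>0 =
     (if S\<^sub>0 = {} then 0 else (\<Sum>s\<in>S\<^sub>0. h\<^sub>0 s) / real (card (boundary_edges \<Gamma> S\<^sub>0)))"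

definition vertex_simplex :: "'v set \<Rightarrow> ('v \<Rightarrow> real) set" where
  "vertex_simplex S = {f \<in> S \<rightarrow>\<^sub>E {0..1}. (\<Sum>s\<in>S. f s) = 1}"

text \<open>
  Functions of type \<open>'v \<Rightarrow> real\<close> form no instance of \<open>real_vector\<close>, so the body of
  \<open>convex_on\<close> is written out for the vector space of functions on \<open>S\<close>.
\<close>

definition convex_on_vertex_simplex :: "'v set \<Rightarrow> (('v \<Rightarrow> real) \<Rightarrow> real) \<Rightarrow> bool" where
  "convex_on_vertex_simplex S A \<longleftrightarrow>
     (\<forall>f \<in> vertex_simplex S. \<forall>g \<in> vertex_simplex S. \<forall>u \<ge> 0. \<forall>v \<ge> 0. u + v = 1 \<longrightarrow>
        (\<lambda>s\<in>S. u * f s + v * g s) \<in> vertex_simplex S \<and>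
        A (\<lambda>s\<in>S. u * f s + v * g s) \<le> u * A f + v * A g)"

definition modification :: "'v set \<Rightarrow> ('v \<Rightarrow> real) \<Rightarrow> ('v \<Rightarrow> real) \<Rightarrow> 'v \<Rightarrow> real" where
  "modification S h\<^sub>0 f v = (if v \<in> S then f v / h\<^sub>0 v else 0)"

definition total_variation ::
  "('v, 'e) graph \<Rightarrow> 'v set \<Rightarrow> ('e \<Rightarrow> 'v) \<Rightarrow> ('e \<Rightarrow> 'v) \<Rightarrow> ('v \<Rightarrow> real) \<Rightarrow> ('v \<Rightarrow> real) \<Rightarrow> real" where
  "total_variation \<Gamma> S i t h\<^sub>0 f =
     (\<Sum>e\<in>edges_meeting \<Gamma> S. \<bar>modification S h\<^sub>0 f (i e) - modification S h\<^sub>0 f (t e)\<bar>)"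

definition is_minimum :: "real \<Rightarrow> real set \<Rightarrow> bool" where
  "is_minimum m X \<longleftrightarrow> m \<in> X \<and> (\<forall>x \<in> X. m \<le> x)"

definition supported_constant_modification ::
  "('v, 'e) graph \<Rightarrow> 'v set \<Rightarrow> ('v \<Rightarrow> real) \<Rightarrow> 'v set \<Rightarrow> ('v \<Rightarrow> real) \<Rightarrow> bool" where
  "supported_constant_modification \<Gamma> S h\<^sub>0 S\<^sub>0 f \<longleftrightarrow>
     (\<exists>k. \<forall>s \<in> S\<^sub>0. modification S h\<^sub>0 f s = k) \<and>
     (\<forall>v \<in> end_vertices \<Gamma> S - S\<^sub>0. modification S h\<^sub>0 f v = 0)"

end

theory Submission
  imports Defs "HOL-Analysis.Function_Topology"
begin

text \<open>
  Summation by parts against the indicator function of \<open>S\<^sub>0\<close> bounds the norm of every cooling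
  function below by the Folner ratio of \<open>S\<^sub>0\<close>.
  Conversely let \<open>N\<close> be the maximal ratio and let \<open>c\<close> minimise the sum of the squared deficits
  \<open>max 0 (h\<^sub>0 s - div c s)\<close> over the compact box \<open>\<bar>c\<bar> \<le> N\<close>. If the set \<open>R\<close> of vertices with
  positive deficit were nonempty, minimality would force every edge leaving \<open>R\<close> to carry the
  full amount \<open>N\<close> outwards, so \<open>H(R) > N * \<bar>\<partial>E(R)\<bar>\<close>, contradicting the choice of \<open>N\<close>.
  Summation by parts of an optimal \<open>c\<close> against a modification gives \<open>A(f) \<ge> 1 / N\<close>, with equality
  for the normalised indicator function of a set of maximal ratio.
\<close>

section \<open>Divergence and summation by parts\<close>

definition divergence ::
  "'e set \<Rightarrow> ('e \<Rightarrow> 'v) \<Rightarrow> ('e \<Rightarrow> 'v) \<Rightarrow> ('e \<Rightarrow> real) \<Rightarrow> 'v \<Rightarrow> real" where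
  "divergence E i t c s = (\<Sum>e | e \<in> E \<and> i e = s. c e) - (\<Sum>e | e \<in> E \<and> t e = s. c e)"

text \<open>Signed incidence coefficients turn both sums into one over a fixed index set, so that
  sums over vertices and edges can be swapped. A loop gets coefficient
  \<open>1 - 1 = 0\<close>.\<close>

lemma divergence_eq_sum:
  assumes "finite E"
  shows "divergence E i t c s = (\<Sum>e\<in>E. c e * (of_bool (i e = s) - of_bool (t e = s)))"
proof -
  have "(\<Sum>e | e \<in> E \<and> p e = s. c e) = (\<Sum>e\<in>E. c e * of_bool (p e = s))" for p :: "'a \<Rightarrow> 'b"
    using assms by (simp add: sum.inter_filter of_bool_def if_distrib cong: if_cong)
  then show ?thesis
    by (simp add: divergence_def right_diff_distrib sum_subtractf)
qed

text \<open>Swapping the two sums collects at each edge the values of \<open>g\<close> at its two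
  ends. Ends outside \<open>S\<close> are missed on the left, but \<open>g\<close> vanishes
  there.\<close>

lemma sum_mult_divergence:
  assumes "finite E" "finite S" "\<And>v. v \<notin> S \<Longrightarrow> g v = 0"
  shows "(\<Sum>s\<in>S. g s * divergence E i t c s) = (\<Sum>e\<in>E. c e * (g (i e) - g (t e)))"
proof -
  have at: "(\<Sum>s\<in>S. g s * of_bool (v = s)) = g v" for v
    using assms by (cases "v \<in> S") (simp_all add: of_bool_def if_distrib cong: if_cong)
  have "(\<Sum>s\<in>S. g s * divergence E i t c s)
      = (\<Sum>s\<in>S. \<Sum>e\<in>E. c e * (g s * of_bool (i e = s) - g s * of_bool (t e = s)))"
    unfolding divergence_eq_sum[OF assms(1)] sum_distrib_left
    by (intro sum.cong refl) (simp add: algebra_simps)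
  also have "\<dots> = (\<Sum>e\<in>E. c e * ((\<Sum>s\<in>S. g s * of_bool (i e = s)) - (\<Sum>s\<in>S. g s * of_bool (t e = s))))"
    by (subst sum.swap) (simp only: sum_distrib_left[symmetric] sum_subtractf)
  finally show ?thesis by (simp add: at)
qed

lemma sum_divergence:
  assumes "finite E" "finite R"
  shows "(\<Sum>s\<in>R. divergence E i t c s) = (\<Sum>e\<in>E. c e * (of_bool (i e \<in> R) - of_bool (t e \<in> R)))"
  using sum_mult_divergence[OF assms, of "\<lambda>v. of_bool (v \<in> R)" i t c] by simp

lemma divergence_upd:
  assumes "finite E" "e \<in> E"
  shows "divergence E i t (c(e := c e + x)) s
       = divergence E i t c s + x * (of_bool (i e = s) - of_bool (t e = s))"
proof -
  have "divergence E i t (c(e := c e + x)) s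
      = (\<Sum>a\<in>E. c a * (of_bool (i a = s) - of_bool (t a = s))
          + (if a = e then x * (of_bool (i e = s) - of_bool (t e = s)) else 0))"
    unfolding divergence_eq_sum[OF assms(1)] by (intro sum.cong refl) (auto simp: algebra_simps)
  then show ?thesis
    using assms by (simp add: sum.distrib divergence_eq_sum)
qed

section \<open>Minimising the squared deficit over a box of flows\<close>

lemma compact_PiE_box:
  fixes a b :: real
  shows "compact (E \<rightarrow>\<^sub>E {a..b})"
proof -
  \<comment> \<open>Off \<open>E\<close> an extensional function can only be
    \<open>undefined\<close>, so the box is a full product with singleton factors there, and
    Tychonoff's theorem applies.\<close>
  have "E \<rightarrow>\<^sub>E {a..b} = (\<Pi>\<^sub>E e\<in>UNIV. if e \<in> E then {a..b} else {undefined})"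
    by (auto simp: PiE_iff extensional_def split: if_splits)
  then show ?thesis
    using compactin_PiE[of "\<lambda>_. euclidean" UNIV "\<lambda>e. if e \<in> E then {a..b} else {undefined}"]
    by (simp add: euclidean_product_topology)
qed

text \<open>Squaring makes it profitable to spread a deficit: moving part of it to a vertex without
  deficit strictly lowers the sum, whereas the sum of the deficits themselves could stay the
  same.\<close>

definition squared_deficit ::
  "'e set \<Rightarrow> ('e \<Rightarrow> 'v) \<Rightarrow> ('e \<Rightarrow> 'v) \<Rightarrow> 'v set \<Rightarrow> ('v \<Rightarrow> real) \<Rightarrow> ('e \<Rightarrow> real) \<Rightarrow> real" where
  "squared_deficit E i t S h c = (\<Sum>s\<in>S. (max 0 (h s - divergence E i t c s))\<^sup>2)"

lemma squared_deficit_minimizer: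
  assumes "finite E" "N \<ge> 0"
  obtains c where "c \<in> E \<rightarrow>\<^sub>E {-N..N}"
    "\<And>c'. c' \<in> E \<rightarrow>\<^sub>E {-N..N} \<Longrightarrow> squared_deficit E i t S h c \<le> squared_deficit E i t S h c'"
proof -
  have "continuous_on (E \<rightarrow>\<^sub>E {-N..N}) (squared_deficit E i t S h)"
    unfolding squared_deficit_def divergence_def
    by (intro continuous_intros continuous_on_subset[OF continuous_on_product_coordinates]) auto
  moreover have "(\<lambda>e\<in>E. 0) \<in> E \<rightarrow>\<^sub>E {-N..N}"
    using assms by auto
  ultimately show ?thesis
    using continuous_attains_inf[OF compact_PiE_box] that by (metis empty_iff)
qed

text \<open>The sign \<open>\<sigma>\<close> treats both directions of \<open>e\<close> at once: the
  update raises the divergence at \<open>u\<close> by \<open>x\<close> and lowers it at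
  \<open>v\<close> by \<open>x\<close>. With \<open>d\<close> the deficit at \<open>u\<close>, the
  term there drops from \<open>d^2\<close> to \<open>(d - x)^2\<close>, while the term at
  \<open>v\<close>, if \<open>v\<close> lies in \<open>S\<close>, grows from 0 to at most
  \<open>x^2\<close>. The total change is at most \<open>-2 * x * (d - x) < 0\<close>.\<close>

lemma squared_deficit_push:
  assumes "finite E" "finite S" "e \<in> E" "u \<in> S" "u \<noteq> v"
    and uv: "\<And>s. of_bool (i e = s) - of_bool (t e = s)
               = \<sigma> * (of_bool (u = s) - of_bool (v = s) :: real)"
    and "\<sigma> * \<sigma> = 1"
    and v: "v \<in> S \<Longrightarrow> h v \<le> divergence E i t c v"
    and x: "0 < x" "x < h u - divergence E i t c u"
  shows "squared_deficit E i t S h (c(e := c e + \<sigma> * x)) < squared_deficit E i t S h c"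
proof -
  let ?d = "\<lambda>c s. max 0 (h s - divergence E i t c s)"
  let ?c = "c(e := c e + \<sigma> * x)"
  have div: "divergence E i t ?c s = divergence E i t c s + x * (of_bool (u = s) - of_bool (v = s))" for s
  proof -
    have "divergence E i t ?c s = divergence E i t c s + (\<sigma> * \<sigma>) * x * (of_bool (u = s) - of_bool (v = s))"
      unfolding divergence_upd[OF assms(1,3)] uv by (simp add: mult_ac)
    then show ?thesis by (simp add: \<open>\<sigma> * \<sigma> = 1\<close>)
  qed
  have "(?d ?c s)\<^sup>2 \<le> (?d c s)\<^sup>2 + (if s = u then x\<^sup>2 - 2 * x * ?d c u else 0) + (if s = v then x\<^sup>2 else 0)"
    if "s \<in> S" for s
  proof -
    consider "s = u" | "s = v" | "s \<noteq> u" "s \<noteq> v" by blast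
    then show ?thesis
    proof cases
      case 1
      with x \<open>u \<noteq> v\<close> div[of u] have "?d ?c s = ?d c u - x" by simp
      then have "(?d ?c s)\<^sup>2 = (?d c u - x)\<^sup>2" by (simp only: 1)
      then show ?thesis using 1 \<open>u \<noteq> v\<close> by (simp add: power2_diff)
    next
      case 2
      with \<open>u \<noteq> v\<close> div[of v] v that x have "?d c s = 0" "?d ?c s \<le> x" by auto
      then have "(?d ?c s)\<^sup>2 \<le> x\<^sup>2" by (intro power_mono) auto
      then show ?thesis using 2 \<open>u \<noteq> v\<close> by (simp add: add_increasing)
    next
      case 3
      then show ?thesis by (simp add: div)
    qed
  qed
  then have "squared_deficit E i t S h ?c \<le> (\<Sum>s\<in>S. (?d c s)\<^sup>2
      + (if s = u then x\<^sup>2 - 2 * x * ?d c u else 0) + (if s = v then x\<^sup>2 else 0))"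
    unfolding squared_deficit_def by (rule sum_mono)
  also have "\<dots> = squared_deficit E i t S h c + (x\<^sup>2 - 2 * x * ?d c u) + (if v \<in> S then x\<^sup>2 else 0)"
    using assms(2,4) by (simp add: sum.distrib squared_deficit_def)
  also have "\<dots> \<le> squared_deficit E i t S h c - 2 * x * (?d c u - x)"
    by (simp add: power2_eq_square algebra_simps)
  also have "\<dots> < squared_deficit E i t S h c"
    using x by simp
  finally show ?thesis .
qed

text \<open>A max-flow min-cut statement: each \<open>s\<close> in \<open>S\<close> supplies
  \<open>h s\<close>, every edge has capacity \<open>N\<close> in both directions, and vertices
  outside \<open>S\<close> absorb without limit. Single-edge pushes at a minimiser replace
  augmenting paths.\<close>

lemma exists_flow_of_cut_condition:
  assumes fin: "finite E" "finite S" and "N \<ge> 0"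
    and cut: "\<And>R. R \<subseteq> S \<Longrightarrow> sum h R \<le> N * real (card {e \<in> E. (i e \<in> R) \<noteq> (t e \<in> R)})"
  obtains c where "c \<in> E \<rightarrow>\<^sub>E {-N..N}" "\<forall>s\<in>S. h s \<le> divergence E i t c s"
proof -
  obtain c where c: "c \<in> E \<rightarrow>\<^sub>E {-N..N}"
    and min: "\<And>c'. c' \<in> E \<rightarrow>\<^sub>E {-N..N} \<Longrightarrow> squared_deficit E i t S h c \<le> squared_deficit E i t S h c'"
    using squared_deficit_minimizer[OF fin(1) \<open>N \<ge> 0\<close>] by metis
  define R where "R = {s \<in> S. divergence E i t c s < h s}"
  have "R \<subseteq> S" "finite R"
    using fin by (auto simp: R_def)
  have bound: "-N \<le> c e" "c e \<le> N" if "e \<in> E" for e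
    using c that by (auto simp: PiE_iff)
  \<comment> \<open>Here \<open>\<sigma> * c e\<close> is the flow out of \<open>R\<close> along
    \<open>e\<close>. The outer end \<open>v\<close> lies outside \<open>S\<close> or has no
    deficit, so spare capacity would permit an improving push.\<close>
  have no_slack: "N \<le> \<sigma> * c e"
    if "e \<in> E" "u \<in> R" "v \<notin> R" and \<sigma>: "\<sigma> = 1 \<and> u = i e \<and> v = t e \<or> \<sigma> = -1 \<and> u = t e \<and> v = i e" for e u v and \<sigma> :: real
  proof (rule ccontr)
    assume "\<not> N \<le> \<sigma> * c e"
    \<comment> \<open>Halving keeps \<open>x\<close> strictly below both the deficit at
      \<open>u\<close> and the spare capacity of \<open>e\<close>: the first makes the push
      improving, the second keeps it in the box.\<close>
    define x where "x = min (h u - divergence E i t c u) (N - \<sigma> * c e) / 2"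
    have x: "0 < x" "x < h u - divergence E i t c u" "x < N - \<sigma> * c e"
      using that \<open>\<not> N \<le> \<sigma> * c e\<close> by (auto simp: x_def R_def)
    have "squared_deficit E i t S h (c(e := c e + \<sigma> * x)) < squared_deficit E i t S h c"
      by (rule squared_deficit_push[of _ _ _ u v]) (use fin that x in \<open>auto simp: R_def\<close>)
    moreover have "c(e := c e + \<sigma> * x) \<in> E \<rightarrow>\<^sub>E {-N..N}"
      using c \<open>e \<in> E\<close> \<sigma> x bound[of e] by (auto simp: PiE_iff extensional_def)
    ultimately show False using min by (meson not_le)
  qed
  have saturated: "c e * (of_bool (i e \<in> R) - of_bool (t e \<in> R)) = N * of_bool ((i e \<in> R) \<noteq> (t e \<in> R))"
    if "e \<in> E" for e
  proof -
    have "c e = N" if "i e \<in> R" "t e \<notin> R"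
      using no_slack[OF \<open>e \<in> E\<close> that, of 1] bound[OF \<open>e \<in> E\<close>] by simp
    moreover have "c e = -N" if "i e \<notin> R" "t e \<in> R"
      using no_slack[OF \<open>e \<in> E\<close> that(2,1), of "-1"] bound[OF \<open>e \<in> E\<close>] by simp
    ultimately show ?thesis by auto
  qed
  have "R = {}"
  proof (rule ccontr)
    assume "R \<noteq> {}"
    \<comment> \<open>By saturation the cut bound for \<open>R\<close> equals the total divergence
      over \<open>R\<close>, where each vertex falls strictly short of its supply.\<close>
    have "sum h R \<le> N * (\<Sum>e\<in>E. of_bool ((i e \<in> R) \<noteq> (t e \<in> R)))"
      using cut[OF \<open>R \<subseteq> S\<close>] fin by (simp add: Int_def conj_commute)
    also have "\<dots> = (\<Sum>s\<in>R. divergence E i t c s)"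
      unfolding sum_divergence[OF fin(1) \<open>finite R\<close>] sum_distrib_left
      by (intro sum.cong refl saturated[symmetric])
    also have "\<dots> < sum h R"
      using \<open>finite R\<close> \<open>R \<noteq> {}\<close> by (intro sum_strict_mono) (auto simp: R_def)
    finally show False by simp
  qed
  with c that show ?thesis by (auto simp: R_def not_less)
qed


section \<open>Boundary edges under a fixed orientation, and convexity of \<open>A\<close>\<close>

lemma finite_edges_meeting:
  assumes "locally_finite_graph \<Gamma>" "S \<subseteq> verts \<Gamma>" "finite S"
  shows "finite (edges_meeting \<Gamma> S)"
proof -
  have "edges_meeting \<Gamma> S = (\<Union>v\<in>S. {e \<in> edges \<Gamma>. v \<in> ends \<Gamma> e})"
    by (auto simp: edges_meeting_def)
  then show ?thesis
    using assms by (auto simp: locally_finite_graph_def)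
qed

text \<open>The orientation points outwards only along the boundary of \<open>S\<close>. An edge in
  the boundary of a smaller set may point either way, hence the symmetric condition.\<close>

lemma boundary_edges_eq:
  assumes "is_orientation \<Gamma> S i t" "S\<^sub>0 \<subseteq> S"
  shows "boundary_edges \<Gamma> S\<^sub>0 = {e \<in> edges_meeting \<Gamma> S. (i e \<in> S\<^sub>0) \<noteq> (t e \<in> S\<^sub>0)}"
proof -
  have "e \<in> boundary_edges \<Gamma> S\<^sub>0 \<longleftrightarrow> (i e \<in> S\<^sub>0) \<noteq> (t e \<in> S\<^sub>0)" if "e \<in> edges_meeting \<Gamma> S" for e
  proof -
    have "ends \<Gamma> e = {i e, t e}" "e \<in> edges \<Gamma>"
      using that assms(1) by (auto simp: is_orientation_def edges_meeting_def)
    then show ?thesis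
      by (auto simp: boundary_edges_def edges_meeting_def)
  qed
  moreover have "boundary_edges \<Gamma> S\<^sub>0 \<subseteq> edges_meeting \<Gamma> S"
    using assms(2) by (auto simp: boundary_edges_def edges_meeting_def)
  ultimately show ?thesis by blast
qed

text \<open>The modification is linear in \<open>f\<close> and reads \<open>f\<close> only on
  \<open>S\<close>, so the restriction to \<open>S\<close> is harmless. Thus \<open>A\<close> is a
  sum of absolute values of linear functions.\<close>

lemma convex_on_vertex_simplex_total_variation:
  "convex_on_vertex_simplex S (total_variation \<Gamma> S i t h)"
  unfolding convex_on_vertex_simplex_def
proof (intro ballI allI impI conjI)
  fix f g and u v :: real
  assume fg: "f \<in> vertex_simplex S" "g \<in> vertex_simplex S" and uv: "0 \<le> u" "0 \<le> v" "u + v = 1"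
  let ?w = "\<lambda>s\<in>S. u * f s + v * g s"
  have "u * f s + v * g s \<in> {0..1}" if "s \<in> S" for s
  proof -
    have "0 \<le> f s" "f s \<le> 1" "0 \<le> g s" "g s \<le> 1"
      using fg that by (auto simp: vertex_simplex_def PiE_iff)
    then show ?thesis
      using uv convex_bound_le[of "f s" 1 "g s" u v] by simp
  qed
  moreover have "(\<Sum>s\<in>S. ?w s) = 1"
    using fg uv by (simp add: vertex_simplex_def sum.distrib flip: sum_distrib_left)
  ultimately show "?w \<in> vertex_simplex S"
    by (auto simp: vertex_simplex_def PiE_iff)
  have mod: "modification S h ?w x = u * modification S h f x + v * modification S h g x" for x
    by (simp add: modification_def add_divide_distrib)
  have "\<bar>modification S h ?w (i e) - modification S h ?w (t e)\<bar>
      \<le> u * \<bar>modification S h f (i e) - modification S h f (t e)\<bar>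
      + v * \<bar>modification S h g (i e) - modification S h g (t e)\<bar>" for e
  proof -
    have "modification S h ?w (i e) - modification S h ?w (t e)
        = u * (modification S h f (i e) - modification S h f (t e))
        + v * (modification S h g (i e) - modification S h g (t e))"
      by (simp add: mod algebra_simps)
    also have "\<bar>\<dots>\<bar> \<le> \<bar>u * (modification S h f (i e) - modification S h f (t e))\<bar>
        + \<bar>v * (modification S h g (i e) - modification S h g (t e))\<bar>"
      by (rule abs_triangle_ineq)
    finally show ?thesis using uv by (simp add: abs_mult)
  qed
  then show "total_variation \<Gamma> S i t h ?w
      \<le> u * total_variation \<Gamma> S i t h f + v * total_variation \<Gamma> S i t h g"
    unfolding total_variation_def sum_distrib_left sum.distrib[symmetric] by (rule sum_mono)
qed

section \<open>Duality between cooling functions and Folner ratios\<close>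

locale cooled_set =
  fixes \<Gamma> :: "('v, 'e) graph" and S :: "'v set" and i t :: "'e \<Rightarrow> 'v" and h :: "'v \<Rightarrow> real"
  assumes locally_finite: "locally_finite_graph \<Gamma>"
    and S: "S \<subseteq> verts \<Gamma>" "finite S" "S \<noteq> {}"
    and orientation: "is_orientation \<Gamma> S i t"
    and h_pos: "s \<in> S \<Longrightarrow> 0 < h s"
    and coolable: "cooling_functions \<Gamma> S i t h \<noteq> {}"
begin

abbreviation E where "E \<equiv> edges_meeting \<Gamma> S"

definition max_ratio where "max_ratio = Max (folner_ratio \<Gamma> h ` Pow S)"

lemma finite_E: "finite E"
  using finite_edges_meeting[OF locally_finite S(1,2)] .

lemma cooling_functions_iff:
  "c \<in> cooling_functions \<Gamma> S i t h \<longleftrightarrow> c \<in> extensional E \<and> (\<forall>s\<in>S. h s \<le> divergence E i t c s)"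
  by (auto simp: cooling_functions_def divergence_def PiE_iff)

lemma abs_le_cooling_norm: "e \<in> E \<Longrightarrow> \<bar>c e\<bar> \<le> cooling_norm \<Gamma> S c"
  using finite_E by (simp add: cooling_norm_def)

lemma card_boundary_edges:
  assumes "S\<^sub>0 \<subseteq> S"
  shows "real (card (boundary_edges \<Gamma> S\<^sub>0)) = (\<Sum>e\<in>E. of_bool ((i e \<in> S\<^sub>0) \<noteq> (t e \<in> S\<^sub>0)))"
  using finite_E by (simp add: boundary_edges_eq[OF orientation assms] Int_def conj_commute)

lemma sum_h_pos: "S\<^sub>0 \<subseteq> S \<Longrightarrow> S\<^sub>0 \<noteq> {} \<Longrightarrow> 0 < sum h S\<^sub>0"
  by (intro sum_pos) (use S h_pos in \<open>auto intro: finite_subset\<close>)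

text \<open>Weak duality: what the vertices of the subset emit must cross its boundary, and no edge
  carries more than the norm. The form without division is needed because it is what proves the
  boundary nonempty.\<close>

lemma sum_h_le_cooling_norm:
  assumes c: "c \<in> cooling_functions \<Gamma> S i t h" and "S\<^sub>0 \<subseteq> S"
  shows "sum h S\<^sub>0 \<le> cooling_norm \<Gamma> S c * card (boundary_edges \<Gamma> S\<^sub>0)"
proof -
  have "finite S\<^sub>0"
    using \<open>S\<^sub>0 \<subseteq> S\<close> S by (auto intro: finite_subset)
  have "sum h S\<^sub>0 \<le> (\<Sum>s\<in>S\<^sub>0. divergence E i t c s)"
    using c \<open>S\<^sub>0 \<subseteq> S\<close> by (intro sum_mono) (auto simp: cooling_functions_iff)
  also have "\<dots> \<le> (\<Sum>e\<in>E. cooling_norm \<Gamma> S c * of_bool ((i e \<in> S\<^sub>0) \<noteq> (t e \<in> S\<^sub>0)))"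
    unfolding sum_divergence[OF finite_E \<open>finite S\<^sub>0\<close>]
  proof (rule sum_mono)
    fix e assume "e \<in> E"
    then show "c e * (of_bool (i e \<in> S\<^sub>0) - of_bool (t e \<in> S\<^sub>0))
        \<le> cooling_norm \<Gamma> S c * of_bool ((i e \<in> S\<^sub>0) \<noteq> (t e \<in> S\<^sub>0))"
      using abs_le_cooling_norm[of e c] by auto
  qed
  finally show ?thesis
    by (simp only: card_boundary_edges[OF \<open>S\<^sub>0 \<subseteq> S\<close>] sum_distrib_left)
qed

lemma card_boundary_edges_pos:
  assumes "S\<^sub>0 \<subseteq> S" "S\<^sub>0 \<noteq> {}"
  shows "0 < card (boundary_edges \<Gamma> S\<^sub>0)"
proof -
  obtain c where "c \<in> cooling_functions \<Gamma> S i t h"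
    using coolable by blast
  from sum_h_le_cooling_norm[OF this assms(1)] sum_h_pos[OF assms] show ?thesis
    by (intro gr0I) simp
qed

lemma folner_ratio_le_max_ratio: "S\<^sub>0 \<subseteq> S \<Longrightarrow> folner_ratio \<Gamma> h S\<^sub>0 \<le> max_ratio"
  using S by (simp add: max_ratio_def)

text \<open>Positivity rules out the empty set, of ratio 0, as a maximiser, and makes the reciprocal
  meaningful.\<close>

lemma max_ratio_pos: "0 < max_ratio"
proof -
  have "0 < folner_ratio \<Gamma> h S"
    using S sum_h_pos[of S] card_boundary_edges_pos[of S] by (simp add: folner_ratio_def)
  with folner_ratio_le_max_ratio[of S] show ?thesis by simp
qed

text \<open>Cleared of its denominator, maximality becomes the cut condition with capacity
  \<open>max_ratio\<close>, valid for the empty set as well.\<close>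

lemma sum_h_le_max_ratio:
  assumes "S\<^sub>0 \<subseteq> S"
  shows "sum h S\<^sub>0 \<le> max_ratio * card (boundary_edges \<Gamma> S\<^sub>0)"
proof (cases "S\<^sub>0 = {}")
  case True
  then show ?thesis using max_ratio_pos by simp
next
  case False
  then show ?thesis
    using folner_ratio_le_max_ratio[OF assms] card_boundary_edges_pos[OF assms False]
    by (simp add: folner_ratio_def pos_divide_le_eq)
qed

lemma folner_ratio_le_cooling_norm:
  assumes c: "c \<in> cooling_functions \<Gamma> S i t h" and "S\<^sub>0 \<subseteq> S" "S\<^sub>0 \<noteq> {}"
  shows "folner_ratio \<Gamma> h S\<^sub>0 \<le> cooling_norm \<Gamma> S c"
  using sum_h_le_cooling_norm[OF assms(1,2)] card_boundary_edges_pos[OF assms(2,3)] assms(3)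
  by (simp add: folner_ratio_def pos_divide_le_eq)

lemma max_ratio_attained:
  obtains S\<^sub>0 where "S\<^sub>0 \<subseteq> S" "S\<^sub>0 \<noteq> {}" "folner_ratio \<Gamma> h S\<^sub>0 = max_ratio"
proof -
  have "max_ratio \<in> folner_ratio \<Gamma> h ` Pow S"
    unfolding max_ratio_def using S by (intro Max_in) auto
  then obtain S\<^sub>0 where S\<^sub>0: "S\<^sub>0 \<subseteq> S" "folner_ratio \<Gamma> h S\<^sub>0 = max_ratio"
    by auto
  then have "S\<^sub>0 \<noteq> {}"
    using max_ratio_pos by (auto simp: folner_ratio_def)
  then show ?thesis using that S\<^sub>0 by metis
qed

lemma max_ratio_le_cooling_norm:
  assumes "c \<in> cooling_functions \<Gamma> S i t h"
  shows "max_ratio \<le> cooling_norm \<Gamma> S c"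
proof -
  obtain S\<^sub>0 where "S\<^sub>0 \<subseteq> S" "S\<^sub>0 \<noteq> {}" "folner_ratio \<Gamma> h S\<^sub>0 = max_ratio"
    by (rule max_ratio_attained)
  with folner_ratio_le_cooling_norm[OF assms] show ?thesis by metis
qed

text \<open>Strong duality: the flow supplied by the cut condition has norm at most
  \<open>max_ratio\<close>, and weak duality gives the reverse inequality.\<close>

lemma optimal_cooling_function:
  obtains c where "c \<in> cooling_functions \<Gamma> S i t h" "cooling_norm \<Gamma> S c = max_ratio"
proof -
  have cut: "sum h R \<le> max_ratio * card {e \<in> E. (i e \<in> R) \<noteq> (t e \<in> R)}" if "R \<subseteq> S" for R
    using sum_h_le_max_ratio[OF that] by (simp only: boundary_edges_eq[OF orientation that])
  obtain c where c: "c \<in> E \<rightarrow>\<^sub>E {-max_ratio..max_ratio}" "\<forall>s\<in>S. h s \<le> divergence E i t c s"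
    by (rule exists_flow_of_cut_condition[OF finite_E S(2) less_imp_le[OF max_ratio_pos] cut])
  then have cooling: "c \<in> cooling_functions \<Gamma> S i t h"
    by (simp add: cooling_functions_iff PiE_iff)
  \<comment> \<open>Bounding the norm needs this, since \<open>Max\<close> of the empty set is
    unspecified.\<close>
  have "E \<noteq> {}"
    using card_boundary_edges_pos[of S] S boundary_edges_eq[OF orientation, of S] by fastforce
  then have "cooling_norm \<Gamma> S c \<le> max_ratio"
    using c(1) finite_E by (auto simp: cooling_norm_def PiE_iff abs_le_iff minus_le_iff)
  with max_ratio_le_cooling_norm[OF cooling] that[OF cooling] show ?thesis by simp
qed

section \<open>The minimum of \<open>A\<close> and its realisation by indicators\<close>

lemma total_variation_ge:
  assumes f: "f \<in> vertex_simplex S"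
  shows "1 / max_ratio \<le> total_variation \<Gamma> S i t h f"
proof -
  obtain c where c: "c \<in> cooling_functions \<Gamma> S i t h" "cooling_norm \<Gamma> S c = max_ratio"
    by (rule optimal_cooling_function)
  let ?g = "modification S h f"
  have "1 = (\<Sum>s\<in>S. f s)"
    using f by (simp add: vertex_simplex_def)
  \<comment> \<open>On \<open>S\<close> one has \<open>f s = ?g s * h s\<close> with
    \<open>?g s\<close> nonnegative, and the divergence of a cooling function dominates
    \<open>h s\<close>.\<close>
  also have "\<dots> \<le> (\<Sum>s\<in>S. ?g s * divergence E i t c s)"
  proof (rule sum_mono)
    fix s assume "s \<in> S"
    then have "0 \<le> f s" "0 < h s" "h s \<le> divergence E i t c s"
      using f c h_pos by (auto simp: vertex_simplex_def PiE_iff cooling_functions_iff)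
    then have "f s / h s * h s \<le> f s / h s * divergence E i t c s"
      by (intro mult_left_mono) auto
    then show "f s \<le> ?g s * divergence E i t c s"
      using \<open>s \<in> S\<close> \<open>0 < h s\<close> by (simp add: modification_def)
  qed
  also have "\<dots> = (\<Sum>e\<in>E. c e * (?g (i e) - ?g (t e)))"
    by (rule sum_mult_divergence[OF finite_E S(2)]) (simp add: modification_def)
  also have "\<dots> \<le> (\<Sum>e\<in>E. max_ratio * \<bar>?g (i e) - ?g (t e)\<bar>)"
  proof (rule sum_mono)
    fix e assume "e \<in> E"
    have "c e * (?g (i e) - ?g (t e)) \<le> \<bar>c e\<bar> * \<bar>?g (i e) - ?g (t e)\<bar>"
      by (metis abs_ge_self abs_mult)
    also have "\<dots> \<le> max_ratio * \<bar>?g (i e) - ?g (t e)\<bar>"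
      using abs_le_cooling_norm[OF \<open>e \<in> E\<close>, of c] c by (intro mult_right_mono) auto
    finally show "c e * (?g (i e) - ?g (t e)) \<le> max_ratio * \<bar>?g (i e) - ?g (t e)\<bar>" .
  qed
  finally show ?thesis
    using max_ratio_pos by (simp add: total_variation_def sum_distrib_left pos_divide_le_eq mult.commute)
qed

text \<open>The weights are proportional to \<open>h\<close> because the modification divides by
  \<open>h\<close>, leaving a constant on the subset.\<close>

definition normalized_indicator where
  "normalized_indicator S\<^sub>0 = (\<lambda>s\<in>S. if s \<in> S\<^sub>0 then h s / sum h S\<^sub>0 else 0)"

lemma modification_normalized_indicator:
  assumes "S\<^sub>0 \<subseteq> S"
  shows "modification S h (normalized_indicator S\<^sub>0) v = of_bool (v \<in> S\<^sub>0) / sum h S\<^sub>0"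
proof (cases "v \<in> S")
  case True
  with h_pos[of v] show ?thesis by (simp add: modification_def normalized_indicator_def)
next
  case False
  with assms show ?thesis by (auto simp: modification_def)
qed

context
  fixes S\<^sub>0 assumes S\<^sub>0: "S\<^sub>0 \<subseteq> S" "S\<^sub>0 \<noteq> {}"
begin

lemma sum_if_mem: "(\<Sum>s\<in>S. if s \<in> S\<^sub>0 then g s else (0::real)) = sum g S\<^sub>0"
  using sum.inter_restrict[OF S(2), of g S\<^sub>0] S\<^sub>0 by (simp add: Int_absorb1)

lemma normalized_indicator_in_vertex_simplex: "normalized_indicator S\<^sub>0 \<in> vertex_simplex S"
proof -
  have "finite S\<^sub>0"
    using S\<^sub>0 S by (auto intro: finite_subset)
  have "h s \<le> sum h S\<^sub>0" "0 < h s" if "s \<in> S\<^sub>0" for s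
    using that S\<^sub>0 h_pos \<open>finite S\<^sub>0\<close> by (auto intro!: member_le_sum simp: less_imp_le subset_iff)
  moreover have "(\<Sum>s\<in>S. if s \<in> S\<^sub>0 then h s / sum h S\<^sub>0 else 0) = 1"
    using sum_h_pos[OF S\<^sub>0] by (simp add: sum_if_mem flip: sum_divide_distrib)
  ultimately show ?thesis
    using sum_h_pos[OF S\<^sub>0]
    by (auto simp: vertex_simplex_def normalized_indicator_def less_imp_le)
qed

text \<open>The modification jumps by \<open>1 / sum h S\<^sub>0\<close> across each boundary edge
  of \<open>S\<^sub>0\<close> and is equal at the two ends of every other edge.\<close>

lemma total_variation_normalized_indicator:
  "total_variation \<Gamma> S i t h (normalized_indicator S\<^sub>0) = 1 / folner_ratio \<Gamma> h S\<^sub>0"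
proof -
  have "total_variation \<Gamma> S i t h (normalized_indicator S\<^sub>0)
      = (\<Sum>e\<in>E. of_bool ((i e \<in> S\<^sub>0) \<noteq> (t e \<in> S\<^sub>0)) / sum h S\<^sub>0)"
    unfolding total_variation_def modification_normalized_indicator[OF S\<^sub>0(1)]
    using sum_h_pos[OF S\<^sub>0] by (intro sum.cong) auto
  also have "\<dots> = real (card (boundary_edges \<Gamma> S\<^sub>0)) / sum h S\<^sub>0"
    by (simp only: card_boundary_edges[OF S\<^sub>0(1)] sum_divide_distrib)
  finally show ?thesis
    using S\<^sub>0 by (simp add: folner_ratio_def)
qed

text \<open>A vertex without incident edges has divergence \<open>0 < h s\<close>, so coolability excludes it.\<close>

lemma subset_end_vertices: "S \<subseteq> end_vertices \<Gamma> S"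
proof
  fix s assume "s \<in> S"
  then obtain e where "e \<in> boundary_edges \<Gamma> {s}"
    using card_boundary_edges_pos[of "{s}"] by fastforce
  with \<open>s \<in> S\<close> show "s \<in> end_vertices \<Gamma> S"
    by (auto simp: boundary_edges_def end_vertices_def edges_meeting_def)
qed

lemma supported_constant_modification_iff:
  assumes f: "f \<in> vertex_simplex S"
  shows "supported_constant_modification \<Gamma> S h S\<^sub>0 f \<longleftrightarrow> f = normalized_indicator S\<^sub>0"
proof
  assume "supported_constant_modification \<Gamma> S h S\<^sub>0 f"
  then obtain k where k: "\<And>s. s \<in> S\<^sub>0 \<Longrightarrow> modification S h f s = k"
    and zero: "\<And>v. v \<in> end_vertices \<Gamma> S - S\<^sub>0 \<Longrightarrow> modification S h f v = 0"
    by (auto simp: supported_constant_modification_def)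
  \<comment> \<open>The hypothesis \<open>zero\<close> speaks of end vertices of edges; it reaches
    all of \<open>S - S\<^sub>0\<close> because every vertex of \<open>S\<close> is one.\<close>
  have fs: "f s = (if s \<in> S\<^sub>0 then k * h s else 0)" if "s \<in> S" for s
    using k[of s] zero[of s] that h_pos[OF that] subset_end_vertices
    by (auto simp: modification_def field_simps split: if_splits)
  \<comment> \<open>Total mass 1 determines the constant \<open>k\<close>, which gives
    uniqueness.\<close>
  have "1 = (\<Sum>s\<in>S. if s \<in> S\<^sub>0 then k * h s else 0)"
    using f fs by (simp add: vertex_simplex_def)
  also have "\<dots> = k * sum h S\<^sub>0"
    by (simp add: sum_if_mem sum_distrib_left)
  finally have "k = 1 / sum h S\<^sub>0"
    using sum_h_pos[OF S\<^sub>0] by (simp add: field_simps)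
  with f fs show "f = normalized_indicator S\<^sub>0"
    by (auto simp: normalized_indicator_def vertex_simplex_def PiE_iff extensional_def)
next
  assume "f = normalized_indicator S\<^sub>0"
  then show "supported_constant_modification \<Gamma> S h S\<^sub>0 f"
    by (auto simp: supported_constant_modification_def modification_normalized_indicator[OF S\<^sub>0(1)])
qed

end

end

section \<open>The three claims assembled, with \<open>max_ratio\<close> as the witness for
  \<open>N\<close>\<close>

theorem theorem2p3:
  fixes \<Gamma> :: "('v, 'e) graph"
    and S :: "'v set"
    and i t :: "'e \<Rightarrow> 'v"
    and h\<^sub>0 :: "'v \<Rightarrow> real"
  assumes "locally_finite_graph \<Gamma>"
    and "S \<subseteq> verts \<Gamma>" and "finite S" and "S \<noteq> {}"
    and "is_orientation \<Gamma> S i t"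
    and "\<forall>s \<in> S. h\<^sub>0 s > 0"
    and "cooling_functions \<Gamma> S i t h\<^sub>0 \<noteq> {}"
  shows "\<exists>N. is_minimum N (cooling_norm \<Gamma> S ` cooling_functions \<Gamma> S i t h\<^sub>0) \<and>
    convex_on_vertex_simplex S (total_variation \<Gamma> S i t h\<^sub>0) \<and>
    is_minimum (1 / N) (total_variation \<Gamma> S i t h\<^sub>0 ` vertex_simplex S) \<and>
    N = Max (folner_ratio \<Gamma> h\<^sub>0 ` Pow S) \<and>
    (\<forall>S\<^sub>0 \<subseteq> S. folner_ratio \<Gamma> h\<^sub>0 S\<^sub>0 = Max (folner_ratio \<Gamma> h\<^sub>0 ` Pow S) \<longrightarrow>
      (\<exists>!f. f \<in> vertex_simplex S \<and> supported_constant_modification \<Gamma> S h\<^sub>0 S\<^sub>0 f) \<and>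
      (\<forall>f \<in> vertex_simplex S. supported_constant_modification \<Gamma> S h\<^sub>0 S\<^sub>0 f \<longrightarrow>
        is_arg_min (total_variation \<Gamma> S i t h\<^sub>0) (\<lambda>g. g \<in> vertex_simplex S) f))"
proof -
  interpret cooled_set \<Gamma> S i t h\<^sub>0
    using assms by unfold_locales auto
  let ?A = "total_variation \<Gamma> S i t h\<^sub>0"
  have "is_minimum max_ratio (cooling_norm \<Gamma> S ` cooling_functions \<Gamma> S i t h\<^sub>0)"
  proof -
    obtain c where "c \<in> cooling_functions \<Gamma> S i t h\<^sub>0" "cooling_norm \<Gamma> S c = max_ratio"
      by (rule optimal_cooling_function)
    then have "max_ratio \<in> cooling_norm \<Gamma> S ` cooling_functions \<Gamma> S i t h\<^sub>0"
      by (metis imageI)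
    then show ?thesis
      using max_ratio_le_cooling_norm by (simp add: is_minimum_def)
  qed
  moreover have "is_minimum (1 / max_ratio) (?A ` vertex_simplex S)"
  proof -
    obtain S\<^sub>0 where S\<^sub>0: "S\<^sub>0 \<subseteq> S" "S\<^sub>0 \<noteq> {}" "folner_ratio \<Gamma> h\<^sub>0 S\<^sub>0 = max_ratio"
      by (rule max_ratio_attained)
    then have "?A (normalized_indicator S\<^sub>0) = 1 / max_ratio"
      by (simp add: total_variation_normalized_indicator)
    with normalized_indicator_in_vertex_simplex[OF S\<^sub>0(1,2)]
    have "1 / max_ratio \<in> ?A ` vertex_simplex S"
      by (metis imageI)
    then show ?thesis
      using total_variation_ge by (simp add: is_minimum_def)
  qed
  moreover have "\<forall>S\<^sub>0 \<subseteq> S. folner_ratio \<Gamma> h\<^sub>0 S\<^sub>0 = max_ratio \<longrightarrow>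
      (\<exists>!f. f \<in> vertex_simplex S \<and> supported_constant_modification \<Gamma> S h\<^sub>0 S\<^sub>0 f) \<and>
      (\<forall>f \<in> vertex_simplex S. supported_constant_modification \<Gamma> S h\<^sub>0 S\<^sub>0 f \<longrightarrow>
        is_arg_min ?A (\<lambda>g. g \<in> vertex_simplex S) f)"
  proof (intro allI impI)
    fix S\<^sub>0 assume max: "S\<^sub>0 \<subseteq> S" "folner_ratio \<Gamma> h\<^sub>0 S\<^sub>0 = max_ratio"
    have S\<^sub>0: "S\<^sub>0 \<subseteq> S" "S\<^sub>0 \<noteq> {}"
      using max max_ratio_pos by (auto simp: folner_ratio_def)
    \<comment> \<open>The indicator has \<open>A\<close>-value \<open>1 / max_ratio\<close>, the
      lower bound over the simplex. As the only function of the required shape, it settles both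
      remaining claims.\<close>
    have "is_arg_min ?A (\<lambda>g. g \<in> vertex_simplex S) (normalized_indicator S\<^sub>0)"
      using normalized_indicator_in_vertex_simplex[OF S\<^sub>0] total_variation_ge
      by (simp add: is_arg_min_linorder total_variation_normalized_indicator[OF S\<^sub>0] max(2))
    then show "(\<exists>!f. f \<in> vertex_simplex S \<and> supported_constant_modification \<Gamma> S h\<^sub>0 S\<^sub>0 f) \<and>
      (\<forall>f \<in> vertex_simplex S. supported_constant_modification \<Gamma> S h\<^sub>0 S\<^sub>0 f \<longrightarrow>
        is_arg_min ?A (\<lambda>g. g \<in> vertex_simplex S) f)"
      using normalized_indicator_in_vertex_simplex[OF S\<^sub>0] supported_constant_modification_iff[OF S\<^sub>0]
      by metis
  qed
  ultimately show ?thesis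
    using convex_on_vertex_simplex_total_variation[of S \<Gamma> i t h\<^sub>0]
    by (intro exI[of _ max_ratio] conjI) (simp_all only: max_ratio_def[symmetric])
qed

end
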